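(* Let $X$, $Y$ be Banach spaces, $\Omega\subseteq X$ an open set and $F:\Omega\to Y$ a continuously differentiable function. Let $x_*\in\Omega$, $R>0$ and $\kappa:=\sup\{t\in[0,R): B(x_*,t)\subset\Omega\}$. Suppose that $F(x_* )=0$, that $F'(x_* )$ is invertible, and that there exist constants $K>0$ and $0<p\leq1$ such that $$\left\|F'(x_* )^{-1}\left[F'(x)-F'(x_*+\tau(x-x_* ))\right]\right\|\leq K(1-\tau^p)\|x-x_*\|^p,\qquad x\in B(x_*,\kappa),\ \tau\in[0,1].$$ Let $r=\min\{\kappa,\,[(p+1)/((2p+1)K)]^{1/p}\}$. Then the sequences with starting points $x_0\in B(x_*,r)\setminus\{x_*\}$ and $t_0=\|x_0-x_*\|$, respectively, $$x_{k+1}=x_k-F'(x_k)^{-1}F(x_k),\qquad t_{k+1}=\frac{K\,p\,t_k^{p+1}}{(p+1)[1-K\,t_k^p]},\qquad k=0,1,\ldots,$$ are well defined; $\{t_k\}$ is strictly decreasing, is contained in $(0,r)$ and converges to $0$; $\{x_k\}$ is contained in $B(x_*,r)$ and converges to $x_*$, which is the unique zero of $F$ in $B\big(x_*,[(p+1)/K]^{1/p}\big)$; and there holds $$\|x_{k+1}-x_*\|\leq\frac{K\,p}{(p+1)[1-K\,t_k^p]}\,\|x_k-x_*\|^{p+1},\qquad k=0,1,\ldots.$$ Moreover, if $[(p+1)/((2p+1)K)]^{1/p}<\kappa$, then $r=[(p+1)/((2p+1)K)]^{1/p}$ is the best possible convergence radius.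
   Context: The Banach spaces are real or complex. $B(x,\delta)=\{y\in X:\|x-y\|<\delta\}$ is the open ball. $F'(x):X\to Y$ denotes the Fréchet derivative of $F$ at $x$ (a bounded linear map). "Well defined" means that at each step $x_k\in\Omega$ with $F'(x_k)$ invertible, and $1-Kt_k^p\neq0$. "$r=[(p+1)/((2p+1)K)]^{1/p}$ is the best possible convergence radius" means that, for the given $R$, $K$, $p$ and $\kappa$, no number $r'>r$ can replace $r$: for every $r'>r$ there exist $(X,Y,\Omega,F,x_* )$ satisfying all the hypotheses with these same $R$, $K$, $p$, $\kappa$, and a starting point $x_0\in\Omega$ with $0<\|x_0-x_*\|<r'$, such that Newton's method started at $x_0$ fails to produce a well defined sequence converging to $x_*$.
   Formalization: Uniqueness of the zero is claimed in B(x_*, min{κ, [(p+1)/K]^{1/p}}) instead of B(x_*, [(p+1)/K]^{1/p}); the latter fails when that radius exceeds κ, e.g. F(x)=x−x³ on the real line, x_*=0, R=1/6, p=1, K=1, where F(1)=0. *)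

theory Defs
  imports "HOL-Analysis.Analysis"
begin

(* Spaces of class banach are real Banach spaces.  A complex Banach space is one of these by
   restriction of scalars; norms, balls and Frechet derivatives do not change, and an invertible
   complex-linear map has a complex-linear inverse, so the complex case is included. *)

definition is_blinfun_inverse ::
    "('a::real_normed_vector \<Rightarrow>\<^sub>L 'b::real_normed_vector) \<Rightarrow> ('b \<Rightarrow>\<^sub>L 'a) \<Rightarrow> bool" where
  "is_blinfun_inverse A B \<longleftrightarrow> B o\<^sub>L A = id_blinfun \<and> A o\<^sub>L B = id_blinfun"

definition blinfun_invertible ::
    "('a::real_normed_vector \<Rightarrow>\<^sub>L 'b::real_normed_vector) \<Rightarrow> bool" where
  "blinfun_invertible A \<longleftrightarrow> (\<exists>B. is_blinfun_inverse A B)"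

(* Meaningful only for invertible A, in which case the inverse is unique. *)
definition blinfun_inv ::
    "('a::real_normed_vector \<Rightarrow>\<^sub>L 'b::real_normed_vector) \<Rightarrow> ('b \<Rightarrow>\<^sub>L 'a)" where
  "blinfun_inv A = (THE B. is_blinfun_inverse A B)"

(* F is a total function, but only its values on the open set \<Omega> matter; there F' is uniquely
   determined as the Frechet derivative of F. *)
definition cont_diff_on ::
    "('a::real_normed_vector \<Rightarrow> 'b::real_normed_vector) \<Rightarrow> ('a \<Rightarrow> 'a \<Rightarrow>\<^sub>L 'b) \<Rightarrow> 'a set \<Rightarrow> bool" where
  "cont_diff_on F F' \<Omega> \<longleftrightarrow>
     (\<forall>x\<in>\<Omega>. (F has_derivative blinfun_apply (F' x)) (at x)) \<and> continuous_on \<Omega> F'"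

definition kappa :: "'a::metric_space set \<Rightarrow> 'a \<Rightarrow> real \<Rightarrow> real" where
  "kappa \<Omega> xs R = Sup {t. 0 \<le> t \<and> t < R \<and> ball xs t \<subseteq> \<Omega>}"

definition newton_hypotheses ::
    "'a::banach set \<Rightarrow> ('a \<Rightarrow> 'b::banach) \<Rightarrow> ('a \<Rightarrow> 'a \<Rightarrow>\<^sub>L 'b) \<Rightarrow> 'a \<Rightarrow> real \<Rightarrow> real \<Rightarrow> real \<Rightarrow> bool" where
  "newton_hypotheses \<Omega> F F' xs R K p \<longleftrightarrow>
     open \<Omega> \<and> cont_diff_on F F' \<Omega> \<and> xs \<in> \<Omega> \<and> 0 < R \<and>
     F xs = 0 \<and> blinfun_invertible (F' xs) \<and> 0 < K \<and> 0 < p \<and> p \<le> 1 \<and>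
     (\<forall>x\<in>ball xs (kappa \<Omega> xs R). \<forall>\<tau>\<in>{0..1}.
        norm (blinfun_inv (F' xs) o\<^sub>L (F' x - F' (xs + \<tau> *\<^sub>R (x - xs))))
          \<le> K * (1 - \<tau> powr p) * norm (x - xs) powr p)"

primrec newton_seq ::
    "('a::real_normed_vector \<Rightarrow> 'b::real_normed_vector) \<Rightarrow> ('a \<Rightarrow> 'a \<Rightarrow>\<^sub>L 'b) \<Rightarrow> 'a \<Rightarrow> nat \<Rightarrow> 'a" where
  "newton_seq F F' x0 0 = x0"
| "newton_seq F F' x0 (Suc k) =
     newton_seq F F' x0 k
       - blinfun_apply (blinfun_inv (F' (newton_seq F F' x0 k))) (F (newton_seq F F' x0 k))"

(* The recursion above is total in HOL; its values are Newton iterates only under this condition. *)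
definition newton_well_defined ::
    "'a::real_normed_vector set \<Rightarrow> ('a \<Rightarrow> 'b::real_normed_vector) \<Rightarrow> ('a \<Rightarrow> 'a \<Rightarrow>\<^sub>L 'b) \<Rightarrow> 'a \<Rightarrow> bool" where
  "newton_well_defined \<Omega> F F' x0 \<longleftrightarrow>
     (\<forall>k. newton_seq F F' x0 k \<in> \<Omega> \<and> blinfun_invertible (F' (newton_seq F F' x0 k)))"

primrec majorant_seq :: "real \<Rightarrow> real \<Rightarrow> real \<Rightarrow> nat \<Rightarrow> real" where
  "majorant_seq K p t0 0 = t0"
| "majorant_seq K p t0 (Suc k) =
     K * p * majorant_seq K p t0 k powr (p + 1)
       / ((p + 1) * (1 - K * majorant_seq K p t0 k powr p))"

definition majorant_well_defined :: "real \<Rightarrow> real \<Rightarrow> real \<Rightarrow> bool" where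
  "majorant_well_defined K p t0 \<longleftrightarrow> (\<forall>k. 1 - K * majorant_seq K p t0 k powr p \<noteq> 0)"

definition optimal_radius :: "real \<Rightarrow> real \<Rightarrow> real" where
  "optimal_radius K p = ((p + 1) / ((2 * p + 1) * K)) powr (1 / p)"

(* No r' > r is a convergence radius for the class of problems with data R, K, p and
   \<kappa> = kap.  HOL cannot quantify over the spaces inside a formula, so the bad problem is
   required to live on the real line, which is stronger than asking for it on some pair of
   Banach spaces. *)
definition best_possible_radius :: "real \<Rightarrow> real \<Rightarrow> real \<Rightarrow> real \<Rightarrow> real \<Rightarrow> bool" where
  "best_possible_radius R K p kap r \<longleftrightarrow>
     (\<forall>r'>r. \<exists>(\<Omega> :: real set) (F :: real \<Rightarrow> real) (F' :: real \<Rightarrow> real \<Rightarrow>\<^sub>L real) xs x0.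
        newton_hypotheses \<Omega> F F' xs R K p \<and> kappa \<Omega> xs R = kap \<and>
        x0 \<in> \<Omega> \<and> 0 < norm (x0 - xs) \<and> norm (x0 - xs) < r' \<and>
        \<not> (newton_well_defined \<Omega> F F' x0 \<and> newton_seq F F' x0 \<longlonglongrightarrow> xs))"

end

theory Submission
  imports Defs
begin

text \<open>Write \<open>u = x - xs\<close> for the error of a point \<open>x\<close>, \<open>A\<close> for the inverse of \<open>F' xs\<close> and
  \<open>T = A \<circ> F' x\<close>. The hypothesis with \<open>\<tau> = 0\<close> says \<open>\<parallel>T - id\<parallel> \<le> K \<parallel>u\<parallel> powr p\<close>. So as long as
  \<open>K \<parallel>u\<parallel> powr p < 1\<close>, the map \<open>T\<close>, and with it \<open>F' x\<close>, is invertible (\<open>near_id_invertible\<close>), and \<open>T\<close>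
  shrinks no vector by more than the factor \<open>1 - K \<parallel>u\<parallel> powr p\<close>. If \<open>x'\<close> is the next Newton iterate, then
  \<open>T (x' - xs) = A (F' x u - F x)\<close>, which is the integral over \<open>\<tau> \<in> [0, 1]\<close> of
  \<open>A (F' x - F' (xs + \<tau> u)) u\<close>. The hypothesis bounds its norm by
  \<open>K \<parallel>u\<parallel> powr (p + 1)\<close> times \<open>\<integral> (1 - \<tau> powr p) d\<tau> = p / (p + 1)\<close> (\<open>newton_residual\<close>). The
  two bounds together are the error estimate (\<open>newton_step\<close>).

  The right-hand side of that estimate is \<open>contraction_factor K p \<parallel>u\<parallel> * \<parallel>u\<parallel>\<close>, and the factor increases
  with \<open>\<parallel>u\<parallel>\<close> and equals \<open>1\<close> exactly at the optimal radius. Below that radius the scalar sequence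
  therefore decreases at least geometrically, and by monotonicity it dominates the errors of the
  Newton iterates (\<open>newton_majorized\<close>).

  The same argument with \<open>F' xs\<close> in place of \<open>F' x\<close> shows that a zero \<open>x\<close> satisfies
  \<open>\<parallel>u\<parallel> \<le> K / (p + 1) * \<parallel>u\<parallel> powr (p + 1)\<close>, hence \<open>u = 0\<close> or \<open>(p + 1) / K \<le> \<parallel>u\<parallel> powr p\<close>.

  All estimates are equalities for the scalar function with derivative \<open>1 - K \<bar>x\<bar> powr p\<close> vanishing at \<open>0\<close>.
  One Newton step then multiplies the error by minus the contraction factor, so that at the optimal
  radius the iterates alternate between two opposite points for ever (\<open>extremal_newton_cycle\<close>).\<close>

section \<open>Bounded linear maps near the identity\<close>

lemma is_blinfun_inverse_unique:
  assumes "is_blinfun_inverse A B" "is_blinfun_inverse A C"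
  shows "B = C"
proof (rule blinfun_eqI)
  fix w
  have "C w = B (A (C w))"
    using assms(1) by (metis blinfun_apply_blinfun_compose blinfun_apply_id_blinfun is_blinfun_inverse_def)
  also have "A (C w) = w"
    using assms(2) by (metis blinfun_apply_blinfun_compose blinfun_apply_id_blinfun is_blinfun_inverse_def)
  finally show "B w = C w" ..
qed

lemma blinfun_inv_eq:
  assumes "is_blinfun_inverse A B"
  shows "blinfun_inv A = B"
  unfolding blinfun_inv_def using assms is_blinfun_inverse_unique by blast

lemma is_blinfun_inverse_blinfun_inv:
  assumes "blinfun_invertible A"
  shows "is_blinfun_inverse A (blinfun_inv A)"
  using assms blinfun_inv_eq unfolding blinfun_invertible_def by metis

lemma is_blinfun_inverse_apply:
  assumes "is_blinfun_inverse A B"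
  shows "B (A v) = v" "A (B w) = w"
proof -
  show "B (A v) = v"
    using assms by (metis blinfun_apply_blinfun_compose blinfun_apply_id_blinfun is_blinfun_inverse_def)
  show "A (B w) = w"
    using assms by (metis blinfun_apply_blinfun_compose blinfun_apply_id_blinfun is_blinfun_inverse_def)
qed

lemma near_id_bounded_below:
  fixes T :: "'a::real_normed_vector \<Rightarrow>\<^sub>L 'a"
  assumes "norm (T - id_blinfun) \<le> c"
  shows "(1 - c) * norm v \<le> norm (T v)"
proof -
  have "norm (T v - v) \<le> c * norm v"
    using norm_blinfun[of "T - id_blinfun" v] assms
    by (metis blinfun.diff_left blinfun_apply_id_blinfun mult_right_mono norm_ge_zero order_trans)
  moreover have "norm v - norm (T v) \<le> norm (T v - v)"
    by (metis norm_minus_commute norm_triangle_ineq2)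
  ultimately show ?thesis by (simp add: algebra_simps)
qed

text \<open>The Banach perturbation lemma. Solving \<open>T v = w\<close> means finding a fixed point of
  \<open>v \<mapsto> w - (T v - v)\<close>, which is a contraction of the complete space; the lower bound above
  makes the solution unique and bounded in terms of \<open>w\<close>.\<close>

lemma near_id_invertible:
  fixes T :: "'a::banach \<Rightarrow>\<^sub>L 'a"
  assumes "norm (T - id_blinfun) < 1"
  shows "blinfun_invertible T"
proof -
  define c where "c = norm (T - id_blinfun)"
  have c: "0 \<le> c" "c < 1" using assms by (auto simp: c_def)
  have below: "(1 - c) * norm v \<le> norm (T v)" for v
    using near_id_bounded_below[of T c] by (simp add: c_def)
  have surj: "\<exists>v. T v = w" for w
  proof -
    have "\<exists>!v\<in>UNIV. w - (T v - v) = v"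
    proof (rule Banach_fix[where c = c])
      show "complete (UNIV::'a set)" by (rule complete_UNIV)
      show "dist (w - (T x - x)) (w - (T y - y)) \<le> c * dist x y" for x y
      proof -
        have "dist (w - (T x - x)) (w - (T y - y)) = norm ((T - id_blinfun) (x - y))"
          by (simp add: dist_norm blinfun.diff_left blinfun.diff_right norm_minus_commute algebra_simps)
        also have "\<dots> \<le> c * dist x y"
          unfolding c_def dist_norm by (rule norm_blinfun)
        finally show ?thesis .
      qed
    qed (use c in auto)
    then obtain v where "w - (T v - v) = v" by auto
    then show ?thesis by (auto simp: algebra_simps)
  qed
  have inj: "v = v'" if "T v = T v'" for v v'
  proof -
    have "(1 - c) * norm (v - v') \<le> 0"
      using below[of "v - v'"] that by (simp add: blinfun.diff_right)
    with c show ?thesis by (simp add: mult_le_0_iff)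
  qed
  define S where "S w = (SOME v. T v = w)" for w
  have TS: "T (S w) = w" for w
    unfolding S_def using surj[of w] by (rule someI_ex)
  have "bounded_linear S"
  proof (rule bounded_linear_intro[where K = "1 / (1 - c)"])
    show "S (x + y) = S x + S y" for x y
      by (rule inj) (simp add: TS blinfun.add_right)
    show "S (a *\<^sub>R x) = a *\<^sub>R S x" for a x
      by (rule inj) (simp add: TS blinfun.scaleR_right)
    show "norm (S x) \<le> norm x * (1 / (1 - c))" for x
      using below[of "S x"] c by (simp add: TS field_simps)
  qed
  then have S: "blinfun_apply (Blinfun S) = S"
    by (rule bounded_linear_Blinfun_apply)
  have "S (T v) = v" for v
    by (rule inj) (rule TS)
  then have "is_blinfun_inverse T (Blinfun S)"
    unfolding is_blinfun_inverse_def
    by (auto intro!: blinfun_eqI simp: S TS)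
  then show ?thesis unfolding blinfun_invertible_def by blast
qed

text \<open>If \<open>S\<close> inverts \<open>B \<circ> M\<close>, then \<open>S \<circ> B\<close> inverts \<open>M\<close>. That it is a right inverse uses that \<open>B\<close>,
  being itself invertible, is injective.\<close>

lemma invertible_if_compose_invertible:
  assumes B: "is_blinfun_inverse L B" and T: "blinfun_invertible (B o\<^sub>L M)"
  shows "blinfun_invertible M"
proof -
  obtain S where S: "is_blinfun_inverse (B o\<^sub>L M) S"
    using T unfolding blinfun_invertible_def by blast
  have "is_blinfun_inverse M (S o\<^sub>L B)"
    unfolding is_blinfun_inverse_def
  proof
    show "(S o\<^sub>L B) o\<^sub>L M = id_blinfun"
      using is_blinfun_inverse_apply(1)[OF S] by (auto intro!: blinfun_eqI)
    show "M o\<^sub>L (S o\<^sub>L B) = id_blinfun"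
    proof (rule blinfun_eqI)
      fix w
      have "M (S (B w)) = L (B (M (S (B w))))"
        by (simp add: is_blinfun_inverse_apply[OF B])
      also have "B (M (S (B w))) = B w"
        using is_blinfun_inverse_apply(2)[OF S, of "B w"] by simp
      finally show "(M o\<^sub>L (S o\<^sub>L B)) w = id_blinfun w"
        by (simp add: is_blinfun_inverse_apply[OF B])
    qed
  qed
  then show ?thesis unfolding blinfun_invertible_def by blast
qed

section \<open>The radius \<open>\<kappa>\<close>\<close>

lemma ball_kappa_subset:
  assumes "0 < R"
  shows "ball z (kappa \<Omega> z R) \<subseteq> \<Omega>"
proof
  fix y assume "y \<in> ball z (kappa \<Omega> z R)"
  then have "dist z y < Sup {t. 0 \<le> t \<and> t < R \<and> ball z t \<subseteq> \<Omega>}"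
    by (simp add: kappa_def)
  moreover have "0 \<in> {t. 0 \<le> t \<and> t < R \<and> ball z t \<subseteq> \<Omega>}"
    using assms by simp
  ultimately obtain t where "t \<in> {t. 0 \<le> t \<and> t < R \<and> ball z t \<subseteq> \<Omega>}" "dist z y < t"
    using less_cSupD by (metis (no_types, lifting) empty_iff)
  then show "y \<in> \<Omega>" by auto
qed

lemma kappa_upper:
  assumes "0 \<le> t" "t < R" "ball z t \<subseteq> \<Omega>"
  shows "t \<le> kappa \<Omega> z R"
  unfolding kappa_def using assms
  by (intro cSup_upper) (auto intro!: bdd_aboveI[where M = R])

lemma kappa_le:
  assumes "0 < R"
  shows "kappa \<Omega> z R \<le> R"
  unfolding kappa_def
proof (rule cSup_least)
  show "{t. 0 \<le> t \<and> t < R \<and> ball z t \<subseteq> \<Omega>} \<noteq> {}"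
    using assms by (auto intro!: exI[of _ 0])
qed auto

lemma kappa_pos:
  assumes "open \<Omega>" "z \<in> \<Omega>" "0 < R"
  shows "0 < kappa \<Omega> z R"
proof -
  obtain e where e: "0 < e" "ball z e \<subseteq> \<Omega>"
    using assms by (meson openE)
  then have "min e (R / 2) \<le> kappa \<Omega> z R"
    using assms by (intro kappa_upper) auto
  with e assms show ?thesis by linarith
qed

text \<open>This allows the counterexample for the sharpness of the radius, posed on a ball, to have any
  value of \<open>\<kappa>\<close> that occurs for the given \<open>R\<close>.\<close>

lemma kappa_ball:
  fixes z :: real
  assumes "0 < \<kappa>" "\<kappa> \<le> R"
  shows "kappa (ball z \<kappa>) z R = \<kappa>"
proof (rule antisym)
  show "kappa (ball z \<kappa>) z R \<le> \<kappa>"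
    unfolding kappa_def
  proof (rule cSup_least)
    show "{t. 0 \<le> t \<and> t < R \<and> ball z t \<subseteq> ball z \<kappa>} \<noteq> {}"
      using assms by (auto intro!: exI[of _ 0])
    show "t \<le> \<kappa>" if "t \<in> {t. 0 \<le> t \<and> t < R \<and> ball z t \<subseteq> ball z \<kappa>}" for t
      using that assms by (auto simp: ball_subset_ball_iff)
  qed
  show "\<kappa> \<le> kappa (ball z \<kappa>) z R"
  proof (rule dense_le)
    fix t assume t: "t < \<kappa>"
    have "max t 0 \<le> kappa (ball z \<kappa>) z R"
      using t assms by (intro kappa_upper) auto
    then show "t \<le> kappa (ball z \<kappa>) z R" by simp
  qed
qed

section \<open>The scalar majorant sequence\<close>

definition contraction_factor :: "real \<Rightarrow> real \<Rightarrow> real \<Rightarrow> real" where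
  "contraction_factor K p t = K * p * t powr p / ((p + 1) * (1 - K * t powr p))"

lemma majorant_seq_Suc_factor:
  assumes "0 < majorant_seq K p t0 k"
  shows "majorant_seq K p t0 (Suc k) =
           contraction_factor K p (majorant_seq K p t0 k) * majorant_seq K p t0 k"
  using assms by (simp add: contraction_factor_def powr_add)

lemma less_powr_inverse_iff:
  fixes t c p :: real
  assumes "0 \<le> t" "0 < p" "0 \<le> c"
  shows "t < c powr (1 / p) \<longleftrightarrow> t powr p < c"
proof -
  have c: "c = (c powr (1 / p)) powr p"
    using assms by (simp add: powr_powr)
  have "t powr p < (c powr (1 / p)) powr p \<longleftrightarrow> t < c powr (1 / p)"
    using assms powr_less_mono2[of p t "c powr (1/p)"] powr_mono2[of p "c powr (1/p)" t]
    by (smt (verit) powr_ge_zero)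
  then show ?thesis using c by simp
qed

lemma less_optimal_radius_iff:
  assumes "0 \<le> t" "0 < K" "0 < p"
  shows "t < optimal_radius K p \<longleftrightarrow> K * t powr p < (p + 1) / (2 * p + 1)"
proof -
  have "t < optimal_radius K p \<longleftrightarrow> t powr p < (p + 1) / ((2 * p + 1) * K)"
    unfolding optimal_radius_def using assms by (intro less_powr_inverse_iff) auto
  also have "\<dots> \<longleftrightarrow> K * t powr p < (p + 1) / (2 * p + 1)"
    using pos_less_divide_eq[OF assms(2), of "t powr p" "(p + 1) / (2 * p + 1)"]
    by (simp add: mult.commute)
  finally show ?thesis .
qed

lemma optimal_radius_powr:
  assumes "0 < K" "0 < p"
  shows "K * optimal_radius K p powr p = (p + 1) / (2 * p + 1)"
  unfolding optimal_radius_def using assms by (simp add: powr_powr)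

lemma below_optimal_radius:
  assumes "0 \<le> t" "t < optimal_radius K p" "0 < K" "0 < p"
  shows "K * t powr p < 1"
proof -
  have "K * t powr p < (p + 1) / (2 * p + 1)"
    using assms less_optimal_radius_iff by blast
  also have "\<dots> < 1" using assms by simp
  finally show ?thesis .
qed

text \<open>With \<open>s = K * t powr p < 1\<close>, the factor is below \<open>1\<close> if and only if \<open>p s < (p + 1) (1 - s)\<close>, that
  is \<open>s < (p + 1) / (2 p + 1)\<close>. This is where the optimal radius comes from.\<close>

lemma contraction_factor_less_1:
  assumes "0 \<le> t" "t < optimal_radius K p" "0 < K" "0 < p"
  shows "contraction_factor K p t < 1"
proof -
  define s where "s = K * t powr p"
  have s: "s < (p + 1) / (2 * p + 1)" "s < 1"
    using assms less_optimal_radius_iff[of t K p] below_optimal_radius[of t K p] by (auto simp: s_def)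
  then have "p * s < (p + 1) * (1 - s)"
    using assms by (simp add: field_simps)
  moreover have "0 < (p + 1) * (1 - s)"
    using s assms by simp
  ultimately have "p * s / ((p + 1) * (1 - s)) < 1" by simp
  then show ?thesis by (simp add: contraction_factor_def s_def mult_ac)
qed

lemma contraction_factor_pos:
  assumes "0 < t" "t < optimal_radius K p" "0 < K" "0 < p"
  shows "0 < contraction_factor K p t"
  using assms below_optimal_radius[of t K p] by (simp add: contraction_factor_def)

lemma contraction_factor_mono:
  assumes "0 \<le> s" "s \<le> t" "K * t powr p < 1" "0 < K" "0 < p"
  shows "contraction_factor K p s \<le> contraction_factor K p t"
  unfolding contraction_factor_def
proof (rule frac_le)
  have le: "s powr p \<le> t powr p" using assms by (intro powr_mono2) auto
  then show "K * p * s powr p \<le> K * p * t powr p"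
    using assms by (intro mult_left_mono) auto
  show "0 \<le> K * p * t powr p" using assms by simp
  show "0 < (p + 1) * (1 - K * t powr p)" using assms by simp
  show "(p + 1) * (1 - K * t powr p) \<le> (p + 1) * (1 - K * s powr p)"
    using assms le by (intro mult_left_mono) auto
qed

text \<open>While the sequence stays below \<open>t0\<close>, monotonicity keeps its factors below the first one, which
  is less than \<open>1\<close>; hence it does stay below \<open>t0\<close> and decays geometrically.\<close>

lemma majorant_seq_props:
  assumes t0: "0 < t0" "t0 < optimal_radius K p" and Kp: "0 < K" "0 < p"
  defines "t \<equiv> majorant_seq K p t0"
  shows majorant_seq_bounds: "0 < t k \<and> t k \<le> t0 * contraction_factor K p t0 ^ k"
    and majorant_seq_le: "t k \<le> t0"
proof -
  define q where "q = contraction_factor K p t0"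
  have q: "0 < q" "q < 1"
    using contraction_factor_less_1[of t0 K p] contraction_factor_pos[of t0 K p] assms
    by (auto simp: q_def)
  have *: "0 < t k \<and> t k \<le> t0 * q ^ k" for k
  proof (induction k)
    case 0
    then show ?case using t0 by (simp add: t_def)
  next
    case (Suc k)
    have "t0 * q ^ k \<le> t0"
      using q t0 by (simp add: power_le_one)
    then have tk: "0 < t k" "t k \<le> t0" using Suc by auto
    then have "0 < contraction_factor K p (t k)"
      using t0 Kp by (intro contraction_factor_pos) auto
    moreover have "contraction_factor K p (t k) \<le> q"
      unfolding q_def using tk t0 Kp below_optimal_radius[of t0 K p]
      by (intro contraction_factor_mono) auto
    moreover have "t (Suc k) = contraction_factor K p (t k) * t k"
      using tk majorant_seq_Suc_factor unfolding t_def by blast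
    ultimately show ?case
      using Suc q tk mult_mono[of "contraction_factor K p (t k)" q "t k" "t0 * q ^ k"]
      by (simp add: mult_ac)
  qed
  then show "0 < t k \<and> t k \<le> t0 * contraction_factor K p t0 ^ k"
    unfolding q_def .
  have "t0 * q ^ k \<le> t0"
    using q t0 by (simp add: power_le_one)
  then show "t k \<le> t0" using * order_trans by blast
qed

lemma majorant_seq_decreasing:
  assumes "0 < t0" "t0 < optimal_radius K p" "0 < K" "0 < p"
  shows "majorant_seq K p t0 (Suc k) < majorant_seq K p t0 k"
proof -
  have t: "0 < majorant_seq K p t0 k" "majorant_seq K p t0 k \<le> t0"
    using majorant_seq_bounds[OF assms] majorant_seq_le[OF assms] by auto
  then have "contraction_factor K p (majorant_seq K p t0 k) < 1"
    using assms by (intro contraction_factor_less_1) auto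
  then show ?thesis
    using t by (simp add: majorant_seq_Suc_factor del: majorant_seq.simps)
qed

lemma majorant_seq_tendsto_0:
  assumes "0 < t0" "t0 < optimal_radius K p" "0 < K" "0 < p"
  shows "majorant_seq K p t0 \<longlonglongrightarrow> 0"
proof (rule tendsto_sandwich[OF _ _ tendsto_const])
  show "(\<lambda>k. t0 * contraction_factor K p t0 ^ k) \<longlonglongrightarrow> 0"
    using contraction_factor_less_1[of t0 K p] contraction_factor_pos[of t0 K p] assms
    by (intro tendsto_mult_right_zero LIMSEQ_realpow_zero) auto
  show "\<forall>\<^sub>F k in sequentially. 0 \<le> majorant_seq K p t0 k"
    using majorant_seq_bounds[OF assms] by (simp add: less_imp_le)
  show "\<forall>\<^sub>F k in sequentially. majorant_seq K p t0 k \<le> t0 * contraction_factor K p t0 ^ k"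
    using majorant_seq_bounds[OF assms] by simp
qed

section \<open>Error estimates for Newton's method\<close>

locale newton_problem =
  fixes \<Omega> :: "'a::banach set" and F :: "'a \<Rightarrow> 'b::banach" and F' :: "'a \<Rightarrow> 'a \<Rightarrow>\<^sub>L 'b"
    and xs :: 'a and R K p :: real
  assumes hyps: "newton_hypotheses \<Omega> F F' xs R K p"
begin

abbreviation \<kappa> :: real where "\<kappa> \<equiv> kappa \<Omega> xs R"

definition A :: "'b \<Rightarrow>\<^sub>L 'a" where "A = blinfun_inv (F' xs)"

lemma K_pos: "0 < K" and p_pos: "0 < p" and R_pos: "0 < R" and F_xs: "F xs = 0"
  using hyps by (auto simp: newton_hypotheses_def)

lemma kappa_positive: "0 < \<kappa>"
  using hyps kappa_pos by (auto simp: newton_hypotheses_def)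

lemma inverse_A: "is_blinfun_inverse (F' xs) A"
  using hyps is_blinfun_inverse_blinfun_inv by (auto simp: A_def newton_hypotheses_def)

lemma in_domain: "norm (x - xs) < \<kappa> \<Longrightarrow> x \<in> \<Omega>"
  using ball_kappa_subset[OF R_pos, of xs \<Omega>] by (auto simp: dist_norm norm_minus_commute)

lemma has_derivative_F: "norm (x - xs) < \<kappa> \<Longrightarrow> (F has_derivative F' x) (at x)"
  using hyps in_domain by (auto simp: newton_hypotheses_def cont_diff_on_def)

lemma radial_Hoelder:
  assumes "norm (x - xs) < \<kappa>" "0 \<le> \<tau>" "\<tau> \<le> 1"
  shows "norm (A o\<^sub>L (F' x - F' (xs + \<tau> *\<^sub>R (x - xs)))) \<le> K * (1 - \<tau> powr p) * norm (x - xs) powr p"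
  using hyps assms by (auto simp: newton_hypotheses_def A_def dist_norm norm_minus_commute)

lemma center_Hoelder:
  assumes "norm (x - xs) < \<kappa>"
  shows "norm ((A o\<^sub>L F' x) - id_blinfun) \<le> K * norm (x - xs) powr p"
proof -
  have "A o\<^sub>L (F' x - F' xs) = (A o\<^sub>L F' x) - id_blinfun"
    using inverse_A by (auto intro!: blinfun_eqI simp: blinfun.diff_left blinfun.diff_right is_blinfun_inverse_apply(1))
  then show ?thesis using radial_Hoelder[OF assms, of 0] by simp
qed

lemma derivative_invertible:
  assumes "norm (x - xs) < \<kappa>" "K * norm (x - xs) powr p < 1"
  shows "blinfun_invertible (F' x)"
  using center_Hoelder[OF assms(1)] assms(2) inverse_A
  by (intro invertible_if_compose_invertible[of "F' xs" A] near_id_invertible) auto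

lemma F_along_segment:
  assumes "norm (x - xs) < \<kappa>" "0 \<le> \<tau>" "\<tau> \<le> 1"
  shows "((\<lambda>\<tau>. F (xs + \<tau> *\<^sub>R (x - xs))) has_vector_derivative
            F' (xs + \<tau> *\<^sub>R (x - xs)) (x - xs)) (at \<tau>)"
proof -
  have "norm ((xs + \<tau> *\<^sub>R (x - xs)) - xs) < \<kappa>"
    using assms mult_left_le_one_le[of "norm (x - xs)" \<tau>] by simp
  then have "(F has_derivative F' (xs + \<tau> *\<^sub>R (x - xs))) (at (xs + \<tau> *\<^sub>R (x - xs)))"
    by (rule has_derivative_F)
  moreover have "((\<lambda>\<tau>. xs + \<tau> *\<^sub>R (x - xs)) has_vector_derivative (x - xs)) (at \<tau>)"
    by (auto intro!: derivative_eq_intros)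
  ultimately show ?thesis
    using vector_derivative_diff_chain_within[of "\<lambda>\<tau>. xs + \<tau> *\<^sub>R (x - xs)" "x - xs" \<tau> UNIV F]
    by (auto simp: o_def intro: has_derivative_at_withinI)
qed

text \<open>The mean value inequality for \<open>\<tau> \<mapsto> A (\<tau> M u - F (xs + \<tau> u))\<close> with \<open>u = x - xs\<close> replaces the
  integral representation of \<open>M u - F x\<close>. The choice \<open>M = F' x\<close> gives the residual of a Newton
  step, and \<open>M = F' xs\<close> the uniqueness of the zero. The bounding function \<open>\<phi>\<close> is a primitive of a
  bound for the derivative, so \<open>\<phi> 1 - \<phi> 0\<close> is the integral of that bound.\<close>

lemma linearization_bound:
  assumes x: "norm (x - xs) < \<kappa>" and \<phi>: "continuous_on {0..1} \<phi>"
    and \<phi>': "\<And>\<tau>. \<lbrakk>0 < \<tau>; \<tau> < 1\<rbrakk> \<Longrightarrow> (\<phi> has_vector_derivative \<phi>' \<tau>) (at \<tau>)"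
    and bound: "\<And>\<tau>. \<lbrakk>0 < \<tau>; \<tau> < 1\<rbrakk> \<Longrightarrow>
      norm (A o\<^sub>L (M - F' (xs + \<tau> *\<^sub>R (x - xs)))) * norm (x - xs) \<le> \<phi>' \<tau>"
  shows "norm (A (M (x - xs) - F x)) \<le> \<phi> 1 - \<phi> 0"
proof -
  define f where "f \<tau> = A (\<tau> *\<^sub>R M (x - xs) - F (xs + \<tau> *\<^sub>R (x - xs)))" for \<tau>
  define f' where "f' \<tau> = (A o\<^sub>L (M - F' (xs + \<tau> *\<^sub>R (x - xs)))) (x - xs)" for \<tau>
  have f': "(f has_vector_derivative f' \<tau>) (at \<tau>)" if "0 \<le> \<tau>" "\<tau> \<le> 1" for \<tau>
  proof -
    have "((\<lambda>\<tau>. \<tau> *\<^sub>R M (x - xs) - F (xs + \<tau> *\<^sub>R (x - xs))) has_vector_derivative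
        M (x - xs) - F' (xs + \<tau> *\<^sub>R (x - xs)) (x - xs)) (at \<tau>)"
      by (rule derivative_eq_intros F_along_segment[OF x that] refl | simp)+
    then show ?thesis
      unfolding f_def f'_def
      using bounded_linear.has_vector_derivative[OF blinfun.bounded_linear_right]
      by (fastforce simp: blinfun.diff_left)
  qed
  have "norm (f 1 - f 0) \<le> \<phi> 1 - \<phi> 0"
  proof (rule differentiable_bound_general[where f' = f' and \<phi>' = \<phi>'])
    show "continuous_on {0..1} f"
      using f' by (auto intro!: continuous_at_imp_continuous_on has_vector_derivative_continuous)
    show "norm (f' \<tau>) \<le> \<phi>' \<tau>" if "0 < \<tau>" "\<tau> < 1" for \<tau>
      unfolding f'_def using bound[OF that] norm_blinfun order_trans by blast
  qed (use \<phi> \<phi>' f' in auto)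
  then show ?thesis by (simp add: f_def F_xs)
qed

lemma powr_primitive:
  assumes "0 < \<tau>"
  shows "((\<lambda>\<tau>. \<tau> powr (p + 1) / (p + 1)) has_vector_derivative \<tau> powr p) (at \<tau>)"
proof -
  have "((\<lambda>\<tau>. \<tau> powr (p + 1) / (p + 1)) has_real_derivative (p + 1) * \<tau> powr (p + 1 - 1) / (p + 1)) (at \<tau>)"
    using assms by (intro DERIV_cdivide has_real_derivative_powr)
  then show ?thesis
    using p_pos by (simp add: has_real_derivative_iff_has_vector_derivative)
qed

lemma continuous_powr_primitive: "continuous_on {0..1} (\<lambda>\<tau>. \<tau> powr (p + 1) / (p + 1))"
  using p_pos by (intro continuous_intros continuous_on_powr') auto

lemma newton_residual:
  assumes "norm (x - xs) < \<kappa>"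
  shows "norm (A (F' x (x - xs) - F x)) \<le> K * p / (p + 1) * norm (x - xs) powr (p + 1)"
proof -
  define c where "c = K * norm (x - xs) powr (p + 1)"
  define \<phi> where "\<phi> \<tau> = c * (\<tau> - \<tau> powr (p + 1) / (p + 1))" for \<tau>
  have "norm (A (F' x (x - xs) - F x)) \<le> \<phi> 1 - \<phi> 0"
  proof (rule linearization_bound[OF assms, where \<phi>' = "\<lambda>\<tau>. c * (1 - \<tau> powr p)"])
    show "continuous_on {0..1} \<phi>"
      unfolding \<phi>_def by (intro continuous_intros continuous_powr_primitive)
    fix \<tau> :: real assume \<tau>: "0 < \<tau>" "\<tau> < 1"
    show "(\<phi> has_vector_derivative c * (1 - \<tau> powr p)) (at \<tau>)"
      unfolding \<phi>_def
      by (intro has_vector_derivative_mult_right has_vector_derivative_diff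
          has_vector_derivative_id powr_primitive \<tau>)
    have "norm (A o\<^sub>L (F' x - F' (xs + \<tau> *\<^sub>R (x - xs)))) * norm (x - xs)
        \<le> K * (1 - \<tau> powr p) * norm (x - xs) powr p * norm (x - xs)"
      using \<tau> assms by (intro mult_right_mono radial_Hoelder) auto
    also have "\<dots> = c * (1 - \<tau> powr p)"
      by (simp add: c_def powr_add)
    finally show "norm (A o\<^sub>L (F' x - F' (xs + \<tau> *\<^sub>R (x - xs)))) * norm (x - xs) \<le> c * (1 - \<tau> powr p)" .
  qed
  also have "\<phi> 1 - \<phi> 0 = K * p / (p + 1) * norm (x - xs) powr (p + 1)"
    using p_pos by (simp add: \<phi>_def c_def field_simps)
  finally show ?thesis .
qed

text \<open>Since \<open>F' x (x' - xs) = F' x (x - xs) - F x\<close>, the map \<open>A \<circ> F' x\<close> sends the new error to the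
  quantity bounded in \<open>newton_residual\<close>; being close to the identity, it is bounded below.\<close>

lemma newton_step:
  fixes x defines "x' \<equiv> x - blinfun_inv (F' x) (F x)"
  assumes x: "norm (x - xs) < \<kappa>" and small: "K * norm (x - xs) powr p < 1"
  shows "norm (x' - xs) \<le> K * p / ((p + 1) * (1 - K * norm (x - xs) powr p)) * norm (x - xs) powr (p + 1)"
proof -
  let ?c = "K * norm (x - xs) powr p"
  have "F' x (blinfun_inv (F' x) (F x)) = F x"
    using is_blinfun_inverse_apply(2)[OF is_blinfun_inverse_blinfun_inv[OF derivative_invertible[OF x small]]] .
  then have "(A o\<^sub>L F' x) (x' - xs) = A (F' x (x - xs) - F x)"
    by (simp add: x'_def blinfun.diff_right)
  then have "(1 - ?c) * norm (x' - xs) \<le> K * p / (p + 1) * norm (x - xs) powr (p + 1)"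
    using near_id_bounded_below[OF center_Hoelder[OF x], of "x' - xs"] newton_residual[OF x] by simp
  then have "norm (x' - xs) \<le> (K * p / (p + 1) * norm (x - xs) powr (p + 1)) / (1 - ?c)"
    using small pos_le_divide_eq[of "1 - ?c" "norm (x' - xs)"] by (simp only: mult.commute)
  then show ?thesis by simp
qed

text \<open>At a zero \<open>x\<close> the linearization error at \<open>xs\<close>, mapped by \<open>A\<close>, is \<open>x - xs\<close> itself. Its bound
  is of higher order in \<open>\<parallel>x - xs\<parallel>\<close>, so it cannot hold for a point close to \<open>xs\<close> but different
  from it.\<close>

lemma zero_near_solution_eq:
  assumes x: "norm (x - xs) < \<kappa>" and zero: "F x = 0" and near: "norm (x - xs) < ((p + 1) / K) powr (1 / p)"
  shows "x = xs"
proof (rule ccontr)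
  assume "x \<noteq> xs"
  define c where "c = K * norm (x - xs) powr (p + 1)"
  define \<phi> where "\<phi> \<tau> = c * (\<tau> powr (p + 1) / (p + 1))" for \<tau>
  have "norm (A (F' xs (x - xs) - F x)) \<le> \<phi> 1 - \<phi> 0"
  proof (rule linearization_bound[OF x, where \<phi>' = "\<lambda>\<tau>. c * \<tau> powr p"])
    show "continuous_on {0..1} \<phi>"
      unfolding \<phi>_def by (intro continuous_intros continuous_powr_primitive)
    fix \<tau> :: real assume \<tau>: "0 < \<tau>" "\<tau> < 1"
    show "(\<phi> has_vector_derivative c * \<tau> powr p) (at \<tau>)"
      unfolding \<phi>_def by (intro has_vector_derivative_mult_right powr_primitive \<tau>)
    let ?y = "xs + \<tau> *\<^sub>R (x - xs)"
    have "norm (?y - xs) < \<kappa>"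
      using x \<tau> mult_left_le_one_le[of "norm (x - xs)" \<tau>] by simp
    then have "norm ((A o\<^sub>L F' ?y) - id_blinfun) \<le> K * norm (?y - xs) powr p"
      by (rule center_Hoelder)
    moreover have "A o\<^sub>L (F' xs - F' ?y) = - ((A o\<^sub>L F' ?y) - id_blinfun)"
      using inverse_A by (auto intro!: blinfun_eqI simp: blinfun.diff_left blinfun.diff_right is_blinfun_inverse_apply(1))
    moreover have "norm (?y - xs) powr p = \<tau> powr p * norm (x - xs) powr p"
      using \<tau> by (simp add: powr_mult)
    ultimately have "norm (A o\<^sub>L (F' xs - F' ?y)) \<le> K * (\<tau> powr p * norm (x - xs) powr p)"
      by (metis norm_minus_cancel)
    then have "norm (A o\<^sub>L (F' xs - F' ?y)) * norm (x - xs)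
        \<le> K * (\<tau> powr p * norm (x - xs) powr p) * norm (x - xs)"
      by (rule mult_right_mono) simp
    also have "\<dots> = c * \<tau> powr p"
      by (simp add: c_def powr_add)
    finally show "norm (A o\<^sub>L (F' xs - F' ?y)) * norm (x - xs) \<le> c * \<tau> powr p" .
  qed
  then have "norm (x - xs) \<le> K * norm (x - xs) powr p / (p + 1) * norm (x - xs)"
    using zero p_pos is_blinfun_inverse_apply(1)[OF inverse_A] by (simp add: \<phi>_def c_def powr_add)
  then have "1 \<le> K * norm (x - xs) powr p / (p + 1)"
    using \<open>x \<noteq> xs\<close> mult_le_cancel_right1[of "norm (x - xs)" "K * norm (x - xs) powr p / (p + 1)"]
    by simp
  moreover have "norm (x - xs) powr p < (p + 1) / K"
    using near K_pos p_pos by (subst (asm) less_powr_inverse_iff) auto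
  ultimately show False
    using K_pos p_pos by (simp add: field_simps)
qed

lemma unique_zero: "{y \<in> ball xs (min \<kappa> (((p + 1) / K) powr (1 / p))). F y = 0} = {xs}"
  using zero_near_solution_eq kappa_positive K_pos p_pos F_xs
  by (auto simp: dist_norm norm_minus_commute)

text \<open>The two claims support each other: the denominator \<open>1 - K * t k powr p\<close> can replace the one in
  \<open>newton_step\<close> only if the majorant bounds the error at step \<open>k\<close>, and the resulting estimate
  has the form of the recursion of the majorant, which gives the bound at step \<open>k + 1\<close>.\<close>

lemma newton_majorized:
  assumes x0: "x0 \<noteq> xs" "norm (x0 - xs) < \<kappa>" "norm (x0 - xs) < optimal_radius K p"
  shows "norm (newton_seq F F' x0 k - xs) \<le> majorant_seq K p (norm (x0 - xs)) k"
    and "norm (newton_seq F F' x0 (Suc k) - xs)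
      \<le> K * p / ((p + 1) * (1 - K * majorant_seq K p (norm (x0 - xs)) k powr p))
          * norm (newton_seq F F' x0 k - xs) powr (p + 1)"
proof -
  define x where "x = newton_seq F F' x0"
  define t where "t = majorant_seq K p (norm (x0 - xs))"
  have pos: "0 < norm (x0 - xs)" using x0 by simp
  have tk: "0 < t k" "t k \<le> norm (x0 - xs)" for k
    using majorant_seq_bounds[OF pos x0(3) K_pos p_pos] majorant_seq_le[OF pos x0(3) K_pos p_pos]
    by (auto simp: t_def)
  have small: "K * t k powr p < 1" for k
    using tk[of k] x0 K_pos p_pos by (intro below_optimal_radius) auto
  have step: "norm (x (Suc k) - xs)
      \<le> K * p / ((p + 1) * (1 - K * t k powr p)) * norm (x k - xs) powr (p + 1)"
    if le: "norm (x k - xs) \<le> t k" for k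
  proof -
    have powr_le: "norm (x k - xs) powr p \<le> t k powr p"
      using le p_pos by (intro powr_mono2) auto
    then have less: "K * norm (x k - xs) powr p \<le> K * t k powr p"
      using K_pos by simp
    have near: "norm (x k - xs) < kappa \<Omega> xs R"
      using le tk[of k] x0 by linarith
    have lt: "K * norm (x k - xs) powr p < 1"
      using less small[of k] by (rule order.strict_trans1)
    have "norm (x (Suc k) - xs)
        \<le> K * p / ((p + 1) * (1 - K * norm (x k - xs) powr p)) * norm (x k - xs) powr (p + 1)"
      using newton_step[OF near lt] by (simp add: x_def)
    also have "\<dots> \<le> K * p / ((p + 1) * (1 - K * t k powr p)) * norm (x k - xs) powr (p + 1)"
      using less lt small[of k] K_pos p_pos
      by (intro mult_right_mono divide_left_mono mult_left_mono mult_pos_pos) auto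
    finally show ?thesis .
  qed
  have le: "norm (x k - xs) \<le> t k" for k
  proof (induction k)
    case 0
    then show ?case by (simp add: x_def t_def)
  next
    case (Suc k)
    have "norm (x (Suc k) - xs)
        \<le> K * p / ((p + 1) * (1 - K * t k powr p)) * norm (x k - xs) powr (p + 1)"
      using step Suc .
    also have "\<dots> \<le> K * p / ((p + 1) * (1 - K * t k powr p)) * t k powr (p + 1)"
      using Suc small[of k] K_pos p_pos by (intro mult_left_mono powr_mono2) auto
    also have "\<dots> = t (Suc k)" by (simp add: t_def)
    finally show ?case .
  qed
  show "norm (newton_seq F F' x0 k - xs) \<le> majorant_seq K p (norm (x0 - xs)) k"
    using le by (simp add: x_def t_def)
  show "norm (newton_seq F F' x0 (Suc k) - xs)
      \<le> K * p / ((p + 1) * (1 - K * majorant_seq K p (norm (x0 - xs)) k powr p))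
          * norm (newton_seq F F' x0 k - xs) powr (p + 1)"
    using step[OF le] unfolding x_def t_def .
qed

end

section \<open>Sharpness of the radius\<close>

text \<open>The primitive vanishing at \<open>0\<close> of \<open>1 - K \<bar>x\<bar> powr p\<close>, the derivative that satisfies the
  hypothesis at the zero \<open>0\<close> with equality.\<close>

definition extremal :: "real \<Rightarrow> real \<Rightarrow> real \<Rightarrow> real" where
  "extremal K p x = x - K / (p + 1) * (x * \<bar>x\<bar> powr p)"

definition extremal_deriv :: "real \<Rightarrow> real \<Rightarrow> real \<Rightarrow> real \<Rightarrow>\<^sub>L real" where
  "extremal_deriv K p x = (1 - K * \<bar>x\<bar> powr p) *\<^sub>R id_blinfun"

text \<open>The power rule survives at \<open>0\<close> because the difference quotient there is \<open>\<bar>h\<bar> powr p\<close>, which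
  tends to \<open>0\<close>.\<close>

lemma DERIV_times_abs_powr:
  fixes x p :: real
  assumes "0 < p"
  shows "((\<lambda>x. x * \<bar>x\<bar> powr p) has_real_derivative (p + 1) * \<bar>x\<bar> powr p) (at x)"
proof -
  consider "0 < x" | "x < 0" | "x = 0" by linarith
  then show ?thesis
  proof cases
    case 1
    have "((\<lambda>x. x * x powr p) has_real_derivative (p + 1) * x powr p) (at x)"
      using 1 by (auto intro!: derivative_eq_intros simp: powr_diff field_simps)
    then show ?thesis
      using 1 by (auto intro: has_field_derivative_transform_within_open[where S = "{0<..}"])
  next
    case 2
    have "((\<lambda>x. x * (- x) powr p) has_real_derivative (p + 1) * (- x) powr p) (at x)"
      using 2 by (auto intro!: derivative_eq_intros simp: powr_diff field_simps)
    then show ?thesis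
      using 2 by (auto intro: has_field_derivative_transform_within_open[where S = "{..<0}"])
  next
    case 3
    have "((\<lambda>h. \<bar>h\<bar> powr p) \<longlongrightarrow> \<bar>0\<bar> powr p) (at (0::real))"
      using assms by (intro tendsto_powr' tendsto_rabs tendsto_ident_at) auto
    then have "((\<lambda>h::real. h * \<bar>h\<bar> powr p / h) \<longlongrightarrow> 0) (at 0)"
      by (rule Lim_transform_eventually[THEN tendsto_eq_rhs]) (use assms in \<open>auto simp: eventually_at_filter\<close>)
    then show ?thesis using 3 assms by (simp add: DERIV_def)
  qed
qed

lemma extremal_has_derivative:
  assumes "0 < p"
  shows "(extremal K p has_derivative extremal_deriv K p x) (at x)"
proof -
  have "(extremal K p has_real_derivative 1 - K / (p + 1) * ((p + 1) * \<bar>x\<bar> powr p)) (at x)"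
    unfolding extremal_def
    by (intro DERIV_diff DERIV_ident DERIV_cmult DERIV_times_abs_powr assms)
  then have "(extremal K p has_real_derivative 1 - K * \<bar>x\<bar> powr p) (at x)"
    using assms by simp
  then show ?thesis
    by (simp add: has_field_derivative_def extremal_deriv_def scaleR_blinfun.rep_eq)
qed

lemma is_blinfun_inverse_scaleR_id:
  "c \<noteq> 0 \<Longrightarrow> is_blinfun_inverse (c *\<^sub>R id_blinfun) ((1 / c) *\<^sub>R id_blinfun)"
  by (auto simp: is_blinfun_inverse_def blinfun.scaleR_left intro!: blinfun_eqI)

lemma extremal_newton_hypotheses:
  assumes K: "0 < K" and p: "0 < p" "p \<le> 1" and \<kappa>: "0 < \<kappa>" "\<kappa> \<le> R"
  shows "newton_hypotheses (ball 0 \<kappa>) (extremal K p) (extremal_deriv K p) 0 R K p"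
proof -
  have at0: "extremal_deriv K p 0 = id_blinfun"
    using p by (simp add: extremal_deriv_def)
  have inv: "is_blinfun_inverse id_blinfun (id_blinfun :: real \<Rightarrow>\<^sub>L real)"
    using is_blinfun_inverse_scaleR_id[of 1] by simp
  have id_compose: "id_blinfun o\<^sub>L M = M" for M :: "real \<Rightarrow>\<^sub>L real"
    by (auto intro!: blinfun_eqI)
  have cont: "continuous_on S (extremal_deriv K p)" for S
    unfolding extremal_deriv_def using p
    by (intro continuous_intros continuous_on_powr') auto
  have "norm (extremal_deriv K p x - extremal_deriv K p (\<tau> * x)) \<le> K * (1 - \<tau> powr p) * \<bar>x\<bar> powr p"
    if "0 \<le> \<tau>" "\<tau> \<le> 1" for x \<tau>
  proof -
    have "extremal_deriv K p x - extremal_deriv K p (\<tau> * x)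
        = (- (K * (1 - \<tau> powr p) * \<bar>x\<bar> powr p)) *\<^sub>R id_blinfun"
      using that by (simp add: extremal_deriv_def abs_mult powr_mult algebra_simps)
    moreover have "\<tau> powr p \<le> 1"
      using that p powr_mono2[of p \<tau> 1] by simp
    ultimately show ?thesis
      using K by (simp add: abs_mult)
  qed
  then show ?thesis
    using assms inv cont extremal_has_derivative
    by (auto simp: newton_hypotheses_def cont_diff_on_def at0 blinfun_inv_eq[OF inv] id_compose
        blinfun_invertible_def extremal_def)
qed

text \<open>At the optimal radius \<open>K \<bar>x\<bar> powr p = (p + 1) / (2 p + 1)\<close>, so the function value is
  \<open>2 p / (2 p + 1) * x\<close> and the derivative is \<open>p / (2 p + 1)\<close>: the Newton correction is \<open>2 x\<close>.\<close>

lemma extremal_newton_cycle: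
  assumes K: "0 < K" and p: "0 < p" and x: "\<bar>x\<bar> = optimal_radius K p"
  shows "x - blinfun_inv (extremal_deriv K p x) (extremal K p x) = - x"
proof -
  have eq: "K * \<bar>x\<bar> powr p = (p + 1) / (2 * p + 1)"
    using optimal_radius_powr[OF K p] x by simp
  then have d: "1 - K * \<bar>x\<bar> powr p = p / (2 * p + 1)"
    using p by (simp add: field_simps)
  have "extremal K p x = x - x * (K * \<bar>x\<bar> powr p) / (p + 1)"
    by (simp add: extremal_def)
  also have "\<dots> = x - x / (2 * p + 1)"
    using p unfolding eq by simp
  also have "\<dots> = 2 * p / (2 * p + 1) * x"
    using p by (simp add: field_simps)
  finally have F: "extremal K p x = 2 * p / (2 * p + 1) * x" .
  have "blinfun_inv (extremal_deriv K p x) = (1 / (p / (2 * p + 1))) *\<^sub>R id_blinfun"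
    unfolding extremal_deriv_def d using p
    by (intro blinfun_inv_eq is_blinfun_inverse_scaleR_id) simp
  moreover have "1 / (p / (2 * p + 1)) * (2 * p / (2 * p + 1) * x) = 2 * x"
    using p by simp
  ultimately show ?thesis
    by (simp only: F blinfun.scaleR_left blinfun_apply_id_blinfun real_scaleR_def)
qed

lemma extremal_newton_not_convergent:
  assumes K: "0 < K" and p: "0 < p"
  shows "\<not> newton_seq (extremal K p) (extremal_deriv K p) (optimal_radius K p) \<longlonglongrightarrow> 0"
proof
  let ?r = "optimal_radius K p" and ?x = "newton_seq (extremal K p) (extremal_deriv K p) (optimal_radius K p)"
  have pos: "0 < ?r"
    using K p by (simp add: optimal_radius_def)
  have abs: "\<bar>?x k\<bar> = ?r" for k
  proof (induction k)
    case 0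
    then show ?case using pos by simp
  next
    case (Suc k)
    then show ?case using extremal_newton_cycle[OF K p Suc] by simp
  qed
  assume "?x \<longlonglongrightarrow> 0"
  then have "(\<lambda>k. \<bar>?x k\<bar>) \<longlonglongrightarrow> 0" by (rule tendsto_rabs_zero)
  then show False using pos by (simp add: abs LIMSEQ_const_iff)
qed

text \<open>Starting at distance exactly \<open>optimal_radius K p\<close> from the zero defeats every larger radius; this
  point lies in the domain because the optimal radius is below \<open>\<kappa>\<close>.\<close>

lemma optimal_radius_best_possible:
  assumes K: "0 < K" and p: "0 < p" "p \<le> 1" and \<kappa>: "optimal_radius K p < \<kappa>" "\<kappa> \<le> R"
  shows "best_possible_radius R K p \<kappa> (optimal_radius K p)"
proof -
  have pos: "0 < optimal_radius K p"
    using K p by (simp add: optimal_radius_def)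
  show ?thesis
    unfolding best_possible_radius_def
    using extremal_newton_hypotheses[of K p \<kappa> R] kappa_ball[of \<kappa> R 0]
      extremal_newton_not_convergent[of K p] K p \<kappa> pos
    by (intro allI impI exI[of _ "ball 0 \<kappa>"] exI[of _ "extremal K p"]
        exI[of _ "extremal_deriv K p"] exI[of _ 0] exI[of _ "optimal_radius K p"]) auto
qed

theorem theorem13:
  fixes \<Omega> :: "'a::banach set" and F :: "'a \<Rightarrow> 'b::banach" and F' :: "'a \<Rightarrow> 'a \<Rightarrow>\<^sub>L 'b"
    and xs :: 'a and R K p \<kappa> r :: real
  assumes hyps: "newton_hypotheses \<Omega> F F' xs R K p"
    and kappa: "\<kappa> = kappa \<Omega> xs R"
    and r: "r = min \<kappa> (optimal_radius K p)"
  shows "(\<forall>x0 \<in> ball xs r - {xs}. \<forall>x t.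
            x = newton_seq F F' x0 \<and> t = majorant_seq K p (norm (x0 - xs)) \<longrightarrow>
              newton_well_defined \<Omega> F F' x0 \<and>
              majorant_well_defined K p (norm (x0 - xs)) \<and>
              (\<forall>k. t (Suc k) < t k) \<and> (\<forall>k. t k \<in> {0<..<r}) \<and> t \<longlonglongrightarrow> 0 \<and>
              (\<forall>k. x k \<in> ball xs r) \<and> x \<longlonglongrightarrow> xs \<and>
              (\<forall>k. norm (x (Suc k) - xs)
                     \<le> K * p / ((p + 1) * (1 - K * t k powr p)) * norm (x k - xs) powr (p + 1)))
       \<and> {y \<in> ball xs (min \<kappa> (((p + 1) / K) powr (1 / p))). F y = 0} = {xs}
       \<and> (optimal_radius K p < \<kappa> \<longrightarrow> best_possible_radius R K p \<kappa> r)"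
proof (intro conjI)
  interpret newton_problem \<Omega> F F' xs R K p
    using hyps by unfold_locales
  show "{y \<in> ball xs (min \<kappa> (((p + 1) / K) powr (1 / p))). F y = 0} = {xs}"
    unfolding kappa by (rule unique_zero)
  show "optimal_radius K p < \<kappa> \<longrightarrow> best_possible_radius R K p \<kappa> r"
    using optimal_radius_best_possible[of K p \<kappa> R] kappa_le[OF R_pos, of \<Omega> xs] hyps
    by (auto simp: r kappa newton_hypotheses_def)
  show "\<forall>x0 \<in> ball xs r - {xs}. \<forall>x t.
            x = newton_seq F F' x0 \<and> t = majorant_seq K p (norm (x0 - xs)) \<longrightarrow>
              newton_well_defined \<Omega> F F' x0 \<and>
              majorant_well_defined K p (norm (x0 - xs)) \<and>
              (\<forall>k. t (Suc k) < t k) \<and> (\<forall>k. t k \<in> {0<..<r}) \<and> t \<longlonglongrightarrow> 0 \<and>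
              (\<forall>k. x k \<in> ball xs r) \<and> x \<longlonglongrightarrow> xs \<and>
              (\<forall>k. norm (x (Suc k) - xs)
                     \<le> K * p / ((p + 1) * (1 - K * t k powr p)) * norm (x k - xs) powr (p + 1))"
  proof (intro ballI allI impI, elim conjE)
    fix x0 x t
    assume x0: "x0 \<in> ball xs r - {xs}"
      and x: "x = newton_seq F F' x0" and t: "t = majorant_seq K p (norm (x0 - xs))"
    have start: "x0 \<noteq> xs" "norm (x0 - xs) < kappa \<Omega> xs R" "norm (x0 - xs) < optimal_radius K p"
      "0 < norm (x0 - xs)" "norm (x0 - xs) < r"
      using x0 by (auto simp: r kappa dist_norm norm_minus_commute)
    have tk: "0 < t k" "t k \<le> norm (x0 - xs)" for k
      using majorant_seq_bounds[OF start(4,3) K_pos p_pos] majorant_seq_le[OF start(4,3) K_pos p_pos]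
      by (auto simp: t)
    have small: "K * t k powr p < 1" for k
      using tk[of k] start K_pos p_pos by (intro below_optimal_radius) auto
    have le: "norm (x k - xs) \<le> t k" for k
      using newton_majorized(1)[OF start(1-3)] by (simp add: x t)
    have near: "norm (x k - xs) < kappa \<Omega> xs R" "norm (x k - xs) < r" for k
      using le[of k] tk[of k] start by linarith+
    have "norm (x k - xs) < optimal_radius K p" for k
      using le[of k] tk[of k] start by linarith
    then have "K * norm (x k - xs) powr p < 1" for k
      using K_pos p_pos by (intro below_optimal_radius) auto
    then have wd: "newton_well_defined \<Omega> F F' x0"
      using near in_domain derivative_invertible unfolding newton_well_defined_def x by blast
    have mwd: "majorant_well_defined K p (norm (x0 - xs))"
      using small unfolding majorant_well_defined_def t by (metis diff_gt_0_iff_gt less_irrefl)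
    have t_lim: "t \<longlonglongrightarrow> 0"
      unfolding t by (rule majorant_seq_tendsto_0[OF start(4,3) K_pos p_pos])
    have "(\<lambda>k. x k - xs) \<longlonglongrightarrow> 0"
      using le by (intro Lim_null_comparison[OF _ t_lim]) simp
    then have x_lim: "x \<longlonglongrightarrow> xs" by (rule LIM_zero_cancel)
    have err: "norm (x (Suc k) - xs)
        \<le> K * p / ((p + 1) * (1 - K * t k powr p)) * norm (x k - xs) powr (p + 1)" for k
      unfolding x t by (rule newton_majorized(2)[OF start(1-3)])
    have dec: "t (Suc k) < t k" for k
      unfolding t by (rule majorant_seq_decreasing[OF start(4,3) K_pos p_pos])
    have range: "t k \<in> {0<..<r}" for k
      using tk[of k] start by auto
    have xball: "x k \<in> ball xs r" for k
      using near(2)[of k] by (simp add: dist_norm norm_minus_commute)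
    show "newton_well_defined \<Omega> F F' x0 \<and>
              majorant_well_defined K p (norm (x0 - xs)) \<and>
              (\<forall>k. t (Suc k) < t k) \<and> (\<forall>k. t k \<in> {0<..<r}) \<and> t \<longlonglongrightarrow> 0 \<and>
              (\<forall>k. x k \<in> ball xs r) \<and> x \<longlonglongrightarrow> xs \<and>
              (\<forall>k. norm (x (Suc k) - xs)
                     \<le> K * p / ((p + 1) * (1 - K * t k powr p)) * norm (x k - xs) powr (p + 1))"
      using wd mwd dec range t_lim xball x_lim err by blast
  qed
qed

end
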